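(* Fix $m\ge1$ and machine speeds $s_1\ge s_2\ge\cdots\ge s_m>0$, write $\frac{\sum_{i=1}^m s_i}{s_1}=t+\Delta$ with $t$ an integer, $1\le t\le m$, and $0\le\Delta<1$, and set $s_{m+1}=0$. Then $WAR(\mathcal{P})\ge\frac{\sum_{i=1}^m s_i}{\sum_{i=1}^t s_i+\Delta s_{t+1}}$ for $\mathcal{P}\in\{Qm(NP),Qm(PP)\}$ on machines with these speeds. If the machine speeds are part of the input (the supremum defining $WAR$ ranges over all speed vectors and all job sets, $m$ fixed), then $WAR(\mathcal{P})\ge\frac{\sqrt{m}+1}{2}$ for $\mathcal{P}\in\{Qm(NP),Qm(PP)\}$.
   Context: Related machines: machines $M_1,\dots,M_m$ with speeds $s_i>0$; jobs $J_1,\dots,J_n$ with standard processing times $p_j>0$; processing $J_j$ entirely on $M_i$ takes time $p_j/s_i$. Schedules start at time $0$ and each machine processes at most one job at any time. In $Qm(NP)$ each job is processed without interruption on a single machine; in $Qm(PP)$ jobs may be interrupted and resumed, possibly on another machine, but each job is on at most one machine at any time. For a feasible schedule $S$, the load $L^S_i$ of $M_i$ is the time by which $M_i$ finishes all processing assigned to it, $L(S)=(L^S_1,\dots,L^S_m)$. For $X\in\mathbb{R}^m$ let $\overleftarrow{X}$ be $X$ sorted in non-increasing order and $\sigma(X)$ its prefix-sum vector; $X\preceq_s Y$ means $\sigma(\overleftarrow{X})\le\sigma(\overleftarrow{Y})$ coordinatewise. For an instance $\mathcal{I}$ with feasible schedules $\mathcal{S}$ and $S\in\mathcal{S}$, $s(S)$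 is the infimum of $\alpha$ with $L(S)\preceq_s\alpha L(T)$ for all $T\in\mathcal{S}$, $s^*(\mathcal{I})=\inf_{S\in\mathcal{S}}s(S)$, and $WAR(\mathcal{P})=\sup_{\mathcal{I}}s^*(\mathcal{I})$ over all instances of the problem. *)

theory Defs
  imports "HOL-Library.Extended_Real"
begin

text \<open>
  Machines are indexed by \<open>{1..m}\<close> and jobs by \<open>{1..n}\<close>; the values of the speeds \<open>s\<close> and the
  processing times \<open>p\<close> outside these ranges are irrelevant.  A schedule is a finite set of pieces,
  a piece being a time interval during which one job is processed without interruption on one
  machine.
\<close>

record piece =
  job :: nat
  machine :: nat
  start :: real
  finish :: real

type_synonym schedule = "piece set"

definition disjoint_pieces :: "piece \<Rightarrow> piece \<Rightarrow> bool" where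
  "disjoint_pieces a b \<longleftrightarrow> {start a<..<finish a} \<inter> {start b<..<finish b} = {}"

definition feasible_PP ::
  "nat \<Rightarrow> (nat \<Rightarrow> real) \<Rightarrow> nat \<Rightarrow> (nat \<Rightarrow> real) \<Rightarrow> schedule \<Rightarrow> bool" where
  "feasible_PP m s n p S \<longleftrightarrow>
     finite S \<and>
     (\<forall>a\<in>S. job a \<in> {1..n} \<and> machine a \<in> {1..m} \<and> 0 \<le> start a \<and> start a < finish a) \<and>
     (\<forall>a\<in>S. \<forall>b\<in>S. a \<noteq> b \<longrightarrow> machine a = machine b \<longrightarrow> disjoint_pieces a b) \<and>
     (\<forall>a\<in>S. \<forall>b\<in>S. a \<noteq> b \<longrightarrow> job a = job b \<longrightarrow> disjoint_pieces a b) \<and>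
     (\<forall>j\<in>{1..n}. (\<Sum>a | a \<in> S \<and> job a = j. s (machine a) * (finish a - start a)) = p j)"

definition feasible_NP ::
  "nat \<Rightarrow> (nat \<Rightarrow> real) \<Rightarrow> nat \<Rightarrow> (nat \<Rightarrow> real) \<Rightarrow> schedule \<Rightarrow> bool" where
  "feasible_NP m s n p S \<longleftrightarrow>
     feasible_PP m s n p S \<and> (\<forall>j\<in>{1..n}. \<exists>!a. a \<in> S \<and> job a = j)"

datatype processing = NP | PP

fun schedules ::
  "processing \<Rightarrow> nat \<Rightarrow> (nat \<Rightarrow> real) \<Rightarrow> nat \<Rightarrow> (nat \<Rightarrow> real) \<Rightarrow> schedule set" where
  "schedules NP m s n p = {S. feasible_NP m s n p S}"
| "schedules PP m s n p = {S. feasible_PP m s n p S}"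

text \<open>The inserted \<open>0\<close> gives a machine that processes nothing the load \<open>0\<close>.\<close>

definition load :: "schedule \<Rightarrow> nat \<Rightarrow> real" where
  "load S i = Max (insert 0 (finish ` {a \<in> S. machine a = i}))"

definition loads :: "nat \<Rightarrow> schedule \<Rightarrow> real list" where
  "loads m S = map (load S) [1..<Suc m]"

definition sort_desc :: "real list \<Rightarrow> real list" where
  "sort_desc X = rev (sort X)"

definition prefix_sums :: "real list \<Rightarrow> real list" where
  "prefix_sums X = map (\<lambda>k. sum_list (take k X)) [1..<Suc (length X)]"

definition submajorized :: "real list \<Rightarrow> real list \<Rightarrow> bool"  (infix "\<preceq>\<^sub>s" 50) where
  "X \<preceq>\<^sub>s Y \<longleftrightarrow> list_all2 (\<le>) (prefix_sums (sort_desc X)) (prefix_sums (sort_desc Y))"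

definition schedule_ratio ::
  "processing \<Rightarrow> nat \<Rightarrow> (nat \<Rightarrow> real) \<Rightarrow> nat \<Rightarrow> (nat \<Rightarrow> real) \<Rightarrow> schedule \<Rightarrow> ereal" where
  "schedule_ratio P m s n p S =
     Inf {ereal \<alpha> |\<alpha>. \<forall>T\<in>schedules P m s n p. loads m S \<preceq>\<^sub>s map ((*) \<alpha>) (loads m T)}"

definition instance_ratio ::
  "processing \<Rightarrow> nat \<Rightarrow> (nat \<Rightarrow> real) \<Rightarrow> nat \<Rightarrow> (nat \<Rightarrow> real) \<Rightarrow> ereal" where
  "instance_ratio P m s n p = (INF S\<in>schedules P m s n p. schedule_ratio P m s n p S)"

definition job_sets :: "(nat \<times> (nat \<Rightarrow> real)) set" where
  "job_sets = {(n, p). 1 \<le> n \<and> (\<forall>j\<in>{1..n}. 0 < p j)}"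

definition speed_vectors :: "nat \<Rightarrow> (nat \<Rightarrow> real) set" where
  "speed_vectors m = {s. \<forall>i\<in>{1..m}. 0 < s i}"

text \<open>
  \<open>V\<close> is the set of admissible speed vectors: \<open>{s}\<close> for fixed speeds, \<open>speed_vectors m\<close> if the speeds
  are part of the input.
\<close>

definition WAR :: "processing \<Rightarrow> nat \<Rightarrow> (nat \<Rightarrow> real) set \<Rightarrow> ereal" where
  "WAR P m V = (SUP s\<in>V. SUP (n, p)\<in>job_sets. instance_ratio P m s n p)"

text \<open>
  By this lemma the infimum in \<open>instance_ratio\<close> is never the extended-real infimum of the empty set.
\<close>

lemma schedules_nonempty:
  assumes "1 \<le> m" "s \<in> speed_vectors m" "(n, p) \<in> job_sets"
  shows "schedules P m s n p \<noteq> {}"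
proof -
  have s: "0 < s 1" and p: "\<And>j. j \<in> {1..n} \<Longrightarrow> 0 < p j"
    using assms by (auto simp: speed_vectors_def job_sets_def)
  define F where "F j = (\<Sum>i=1..j. p i / s 1)" for j :: nat
  define q where "q j = \<lparr>job = j, machine = 1, start = F (j - 1), finish = F j\<rparr>" for j
  have F_step: "F j = F (j - 1) + p j / s 1" if "j \<ge> 1" for j
    using that by (cases j) (auto simp: F_def)
  have F_less: "F (j - 1) < F j" if "j \<in> {1..n}" for j
    using that s p by (subst (2) F_step) auto
  have F_mono: "F i \<le> F j" if "i \<le> j" "j \<le> n" for i j
    unfolding F_def using that s p by (intro sum_mono2) (auto intro!: divide_nonneg_pos less_imp_le)
  have F_nonneg: "0 \<le> F j" if "j \<le> n" for j
    using F_mono[of 0 j] that by (simp add: F_def)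
  have disj: "disjoint_pieces (q i) (q j)" if "i \<in> {1..n}" "j \<in> {1..n}" "i \<noteq> j" for i j
  proof (cases "i < j")
    case True
    then have "F i \<le> F (j - 1)" using that by (intro F_mono) auto
    then show ?thesis by (auto simp: disjoint_pieces_def q_def simp del: Int_greaterThanLessThan)
  next
    case False
    then have "F j \<le> F (i - 1)" using that by (intro F_mono) auto
    then show ?thesis by (auto simp: disjoint_pieces_def q_def simp del: Int_greaterThanLessThan)
  qed
  have pieces: "{a. a \<in> q ` {1..n} \<and> job a = j} = {q j}" if "j \<in> {1..n}" for j
    using that by (auto simp: q_def)
  have work: "s 1 * (F j - F (j - 1)) = p j" if "j \<in> {1..n}" for j
    using that s by (subst F_step) auto
  have "feasible_PP m s n p (q ` {1..n})"
    unfolding feasible_PP_def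
  proof (intro conjI)
    show "\<forall>a\<in>q ` {1..n}. job a \<in> {1..n} \<and> machine a \<in> {1..m} \<and> 0 \<le> start a \<and> start a < finish a"
      using assms(1) F_nonneg F_less by (auto simp: q_def)
    show "\<forall>a\<in>q ` {1..n}. \<forall>b\<in>q ` {1..n}. a \<noteq> b \<longrightarrow> machine a = machine b \<longrightarrow> disjoint_pieces a b"
      "\<forall>a\<in>q ` {1..n}. \<forall>b\<in>q ` {1..n}. a \<noteq> b \<longrightarrow> job a = job b \<longrightarrow> disjoint_pieces a b"
      by (intro ballI impI; elim imageE; metis disj)+
    show "\<forall>j\<in>{1..n}. (\<Sum>a | a \<in> q ` {1..n} \<and> job a = j. s (machine a) * (finish a - start a)) = p j"
    proof
      fix j assume j: "j \<in> {1..n}"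
      show "(\<Sum>a | a \<in> q ` {1..n} \<and> job a = j. s (machine a) * (finish a - start a)) = p j"
        unfolding pieces[OF j] using work[OF j] by (simp add: q_def)
    qed
  qed simp
  moreover have "\<forall>j\<in>{1..n}. \<exists>!a. a \<in> q ` {1..n} \<and> job a = j"
  proof
    fix j assume "j \<in> {1..n}"
    then show "\<exists>!a. a \<in> q ` {1..n} \<and> job a = j"
      by (intro ex1I[of _ "q j"]) (auto simp: q_def)
  qed
  ultimately show ?thesis
    by (cases P) (auto simp: feasible_NP_def)
qed

end

theory Submission
  imports Defs "HOL-Library.Multiset"
begin

text \<open>
  Take one job of size \<open>s i\<close> for every machine \<open>i\<close>.  Running each job on its own machine makes all
  loads equal to \<open>1\<close>, while running all jobs on the fastest machine makes the total load
  \<open>\<tau> = (\<Sum>i=1..m. s i) / s 1\<close>.  Hence if \<open>S\<close> has ratio \<open>\<alpha>\<close>, then the loads of any \<open>k\<close> machines in \<open>S\<close>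
  sum up to at most \<open>\<alpha> * min k \<tau>\<close>.  Since the speeds decrease, Abel summation shows that \<open>S\<close> processes at
  most \<open>\<alpha> * ((\<Sum>i=1..t. s i) + \<Delta> * s (t + 1))\<close> in total, but it has to process \<open>\<Sum>i=1..m. s i\<close>.  The
  speeds \<open>1 + sqrt m, 1, \<dots>, 1\<close> maximise the resulting bound among all vectors \<open>x, 1, \<dots>, 1\<close>.
\<close>

section \<open>Abel summation with decreasing weights\<close>

text \<open>For \<open>d = y - x\<close> with prefix sums \<open>D k\<close>, Abel summation turns
  the sum of \<open>s i * d i\<close> into \<open>s m * D m\<close> plus the terms
  \<open>(s k - s (k + 1)) * D k\<close> for \<open>k < m\<close>, all of them nonnegative.\<close>

lemma sum_mult_antimono_le:
  fixes s x y :: "nat \<Rightarrow> real"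
  assumes "\<And>i. i \<in> {1..m} \<Longrightarrow> 0 \<le> s i"
    and "\<And>i j. 1 \<le> i \<Longrightarrow> i \<le> j \<Longrightarrow> j \<le> m \<Longrightarrow> s j \<le> s i"
    and "\<And>k. k \<in> {1..m} \<Longrightarrow> (\<Sum>i=1..k. x i) \<le> (\<Sum>i=1..k. y i)"
  shows "(\<Sum>i=1..m. s i * x i) \<le> (\<Sum>i=1..m. s i * y i)"
proof -
  define d where "d i = y i - x i" for i
  have d: "0 \<le> (\<Sum>i=1..k. d i)" if "k \<in> {1..m}" for k
    using assms(3)[OF that] by (simp add: d_def sum_subtractf)
  \<comment> \<open>Only the boundary term of the Abel sum is kept: in the induction step the weight
    \<open>s k\<close> on a nonnegative prefix sum drops to \<open>s (Suc k)\<close>.\<close>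
  have abel: "s k * (\<Sum>i=1..k. d i) \<le> (\<Sum>i=1..k. s i * d i)" if "k \<le> m" for k
    using that
  proof (induction k)
    case (Suc k)
    show ?case
    proof (cases "k = 0")
      case False
      then have "s (Suc k) * (\<Sum>i=1..k. d i) \<le> s k * (\<Sum>i=1..k. d i)"
        using Suc.prems assms(2)[of k "Suc k"] d[of k] by (intro mult_right_mono) auto
      with Suc show ?thesis by (simp add: distrib_left)
    qed simp
  qed simp
  have "0 \<le> (\<Sum>i=1..m. s i * d i)"
  proof (cases "m = 0")
    case False
    then have "0 \<le> s m * (\<Sum>i=1..m. d i)" using assms(1) d by (intro mult_nonneg_nonneg) auto
    with abel[of m] show ?thesis by simp
  qed simp
  then show ?thesis by (simp add: d_def right_diff_distrib sum_subtractf)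
qed

section \<open>Sums of largest entries and submajorization\<close>

lemma sum_list_take_le:
  fixes xs :: "real list"
  assumes "\<And>x. x \<in> set xs \<Longrightarrow> 0 \<le> x"
  shows "sum_list (take k xs) \<le> sum_list xs"
proof -
  have "0 \<le> sum_list (drop k xs)"
    using assms by (intro sum_list_nonneg) (auto dest: in_set_dropD)
  moreover have "sum_list xs = sum_list (take k xs) + sum_list (drop k xs)"
    by (metis append_take_drop_id sum_list_append)
  ultimately show ?thesis by simp
qed

lemma length_sort_desc [simp]: "length (sort_desc xs) = length xs"
  by (simp add: sort_desc_def)

lemma set_sort_desc [simp]: "set (sort_desc xs) = set xs"
  by (simp add: sort_desc_def)

lemma mset_sort_desc [simp]: "mset (sort_desc xs) = mset xs"
  by (simp add: sort_desc_def)

lemma sum_list_map_sort_desc: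
  fixes f :: "real \<Rightarrow> real"
  shows "sum_list (map f (sort_desc xs)) = sum_list (map f xs)"
  by (metis mset_map mset_sort_desc sum_mset_sum_list)

text \<open>
  With \<open>y\<close> the \<open>k\<close>-th largest entry, the \<open>k\<close> largest entries sum up to \<open>k * y\<close> plus the sum of
  \<open>max (x - y) 0\<close> over all entries, which does not depend on their order.
\<close>

lemma sum_list_take_le_sort_desc:
  assumes "k \<le> length xs"
  shows "sum_list (take k xs) \<le> sum_list (take k (sort_desc xs))"
proof (cases "k = 0")
  case False
  define ys where "ys = sort_desc xs"
  define y where "y = ys ! (k - 1)"
  define f where "f x = max (x - y) 0" for x
  have len: "length ys = length xs" by (simp add: ys_def)
  have desc: "ys ! j \<le> ys ! i" if "i \<le> j" "j < length ys" for i j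
    using that by (auto simp: ys_def sort_desc_def rev_nth intro!: sorted_nth_mono)
  have *: "sum_list zs \<le> real (length zs) * y + sum_list (map f zs)" for zs
    by (induction zs) (auto simp: f_def algebra_simps)
  have f_nonneg: "0 \<le> x" if "x \<in> set (map f xs)" for x
    using that by (auto simp: f_def)
  have "sum_list (take k xs) \<le> real k * y + sum_list (map f (take k xs))"
    using *[of "take k xs"] assms by simp
  also have "\<dots> \<le> real k * y + sum_list (map f xs)"
    using sum_list_take_le[of "map f xs" k] f_nonneg by (simp add: take_map)
  also have "sum_list (map f xs) = sum_list (map f (take k ys @ drop k ys))"
    by (simp only: append_take_drop_id ys_def sum_list_map_sort_desc)
  also have "\<dots> = sum_list (map f (take k ys)) + sum_list (map f (drop k ys))"
    by (simp only: map_append sum_list_append)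
  also have "map f (drop k ys) = map (\<lambda>_. 0) (drop k ys)"
  proof (rule map_cong[OF refl])
    fix x assume "x \<in> set (drop k ys)"
    then obtain j where "j < length (drop k ys)" "x = drop k ys ! j"
      by (metis in_set_conv_nth)
    then have "x \<le> y" using desc[of "k - 1" "k + j"] by (auto simp: y_def)
    then show "f x = 0" by (simp add: f_def)
  qed
  also have "map f (take k ys) = map (\<lambda>x. x - y) (take k ys)"
  proof (rule map_cong[OF refl])
    fix x assume "x \<in> set (take k ys)"
    then obtain j where "j < length (take k ys)" "x = take k ys ! j"
      by (metis in_set_conv_nth)
    then have "y \<le> x" using desc[of j "k - 1"] assms len by (auto simp: y_def)
    then show "f x = x - y" by (simp add: f_def)
  qed
  also have "sum_list (map (\<lambda>x. x - y) (take k ys)) = sum_list (take k ys) - real k * y"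
    using assms len by (simp add: sum_list_subtractf sum_list_triv)
  finally show ?thesis by (simp add: ys_def)
qed simp

lemma submajorizedD:
  assumes "xs \<preceq>\<^sub>s ys" "k \<le> length xs"
  shows "sum_list (take k (sort_desc xs)) \<le> sum_list (take k (sort_desc ys))"
proof (cases "k = 0")
  \<comment> \<open>\<open>prefix_sums\<close> omits the empty prefix, so the sum of
    \<open>k\<close> entries stands at index \<open>k - 1\<close>.\<close>
  case False
  then have "k - 1 < length (prefix_sums (sort_desc xs))" using assms by (simp add: prefix_sums_def)
  moreover have "list_all2 (\<le>) (prefix_sums (sort_desc xs)) (prefix_sums (sort_desc ys))"
    using assms by (simp add: submajorized_def)
  ultimately have "prefix_sums (sort_desc xs) ! (k - 1) \<le> prefix_sums (sort_desc ys) ! (k - 1)"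
    and "k - 1 < length (prefix_sums (sort_desc ys))"
    by (auto dest: list_all2_nthD list_all2_lengthD)
  with False assms show ?thesis by (auto simp: prefix_sums_def simp del: upt_Suc)
qed simp

text \<open>Sorting leaves a constant list unchanged, and no \<open>k\<close> entries of
  \<open>xs\<close> exceed its \<open>k\<close> largest in sum. This yields the cap from the
  schedule with unit loads.\<close>

lemma submajorized_replicate_le:
  assumes "xs \<preceq>\<^sub>s replicate n c" "k \<le> length xs"
  shows "sum_list (take k xs) \<le> real k * c"
proof -
  have "length (prefix_sums (sort_desc xs)) = length (prefix_sums (sort_desc (replicate n c)))"
    using assms(1) unfolding submajorized_def by (rule list_all2_lengthD)
  then have len: "length xs = n" by (simp add: prefix_sums_def del: upt_Suc)
  have "sort_desc (replicate n c) = replicate n c"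
    by (simp add: sort_desc_def sorted_sort_id)
  with submajorizedD[OF assms] sum_list_take_le_sort_desc[OF assms(2)] assms(2) len
  show ?thesis by (simp add: sum_list_replicate)
qed

text \<open>For nonnegative \<open>ys\<close> the total bounds every prefix sum, which gives a cap
  independent of \<open>k\<close>. It serves the comparison with the serial schedule.\<close>

lemma submajorized_nonneg_le:
  assumes "xs \<preceq>\<^sub>s ys" "k \<le> length xs" "\<And>y. y \<in> set ys \<Longrightarrow> 0 \<le> y"
  shows "sum_list (take k xs) \<le> sum_list ys"
proof -
  have "sum_list (take k (sort_desc ys)) \<le> sum_list (sort_desc ys)"
    using assms(3) by (intro sum_list_take_le) simp
  also have "\<dots> = sum_list ys" using sum_list_map_sort_desc[of "\<lambda>x. x" ys] by simp
  finally show ?thesis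
    using submajorizedD[OF assms(1,2)] sum_list_take_le_sort_desc[OF assms(2)] by linarith
qed

section \<open>Processed work and loads\<close>

text \<open>Pieces are added in order of their start. All earlier ones must have ended when the new
  one starts, so its length fits between the old maximum and its own end.\<close>

lemma sum_disjoint_pieces_le:
  assumes "finite A"
    and "\<And>a. a \<in> A \<Longrightarrow> 0 \<le> start a \<and> start a < finish a"
    and "\<And>a b. a \<in> A \<Longrightarrow> b \<in> A \<Longrightarrow> a \<noteq> b \<Longrightarrow> disjoint_pieces a b"
  shows "(\<Sum>a\<in>A. finish a - start a) \<le> Max (insert 0 (finish ` A))"
  using assms
proof (induction A rule: finite_ranking_induct[where f = start])
  case (insert a A)
  show ?case
  \<comment> \<open>The induction rule does not exclude that the inserted element is already
    present.\<close>
  proof (cases "a \<in> A")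
    case True
    with insert show ?thesis by (simp add: insert_absorb)
  next
    case False
    have "finish b \<le> start a" if "b \<in> A" for b
    proof (rule ccontr)
      assume "\<not> finish b \<le> start a"
      moreover have "start b \<le> start a" "start a < finish a" using insert that by auto
      ultimately obtain z where "start a < z" "z < finish a" "z < finish b"
        using dense[of "start a" "min (finish a) (finish b)"] by auto
      with \<open>start b \<le> start a\<close>
      have "z \<in> {start a<..<finish a} \<inter> {start b<..<finish b}" by auto
      moreover have "disjoint_pieces a b" using insert.prems(2) that False by auto
      ultimately show False by (auto simp: disjoint_pieces_def simp del: Int_greaterThanLessThan)
    qed
    then have "Max (insert 0 (finish ` A)) \<le> start a" using insert by auto
    moreover have "(\<Sum>b\<in>A. finish b - start b) \<le> Max (insert 0 (finish ` A))" using insert by auto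
    moreover have "finish a \<le> Max (insert 0 (finish ` insert a A))" using insert by (intro Max_ge) auto
    moreover have "(\<Sum>b\<in>insert a A. finish b - start b) =
        finish a - start a + (\<Sum>b\<in>A. finish b - start b)"
      using False insert by simp
    ultimately show ?thesis by linarith
  qed
qed simp

lemma load_nonneg: "finite S \<Longrightarrow> 0 \<le> load S i"
  by (simp add: load_def)

text \<open>Double counting of the work: grouped by job it gives the processing times, grouped by
  machine at most speed times load, as idle time only increases the load.\<close>

lemma total_work_le:
  assumes "feasible_PP m s n p S" "\<And>i. i \<in> {1..m} \<Longrightarrow> 0 \<le> s i"
  shows "(\<Sum>j=1..n. p j) \<le> (\<Sum>i=1..m. s i * load S i)"
proof -
  let ?w = "\<lambda>a. s (machine a) * (finish a - start a)"
  have fin: "finite S" and jobs: "job ` S \<subseteq> {1..n}" and machines: "machine ` S \<subseteq> {1..m}"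
    using assms(1) by (auto simp: feasible_PP_def)
  have "(\<Sum>j=1..n. p j) = (\<Sum>j=1..n. \<Sum>a | a \<in> S \<and> job a = j. ?w a)"
    using assms(1) by (simp add: feasible_PP_def)
  also have "\<dots> = (\<Sum>a\<in>S. ?w a)" by (rule sum.group[OF fin _ jobs]) simp
  also have "\<dots> = (\<Sum>i=1..m. \<Sum>a | a \<in> S \<and> machine a = i. ?w a)"
    by (rule sum.group[OF fin _ machines, symmetric]) simp
  also have "\<dots> = (\<Sum>i=1..m. s i * (\<Sum>a | a \<in> S \<and> machine a = i. finish a - start a))"
    by (intro sum.cong refl) (simp add: sum_distrib_left)
  also have "\<dots> \<le> (\<Sum>i=1..m. s i * load S i)"
    unfolding load_def using assms
    by (intro sum_mono mult_left_mono sum_disjoint_pieces_le) (auto simp: feasible_PP_def)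
  finally show ?thesis .
qed

section \<open>The two comparison schedules\<close>

text \<open>With a single piece \<open>q j\<close> per job, distinct pieces belong to distinct jobs,
  so only pieces sharing a machine can conflict.\<close>

lemma feasible_NP_imageI:
  assumes "\<And>j. j \<in> {1..n} \<Longrightarrow> job (q j) = j \<and> machine (q j) \<in> {1..m} \<and> 0 \<le> start (q j)
      \<and> start (q j) < finish (q j) \<and> s (machine (q j)) * (finish (q j) - start (q j)) = p j"
    and "\<And>i j. i \<in> {1..n} \<Longrightarrow> j \<in> {1..n} \<Longrightarrow> i < j \<Longrightarrow> machine (q i) = machine (q j)
      \<Longrightarrow> finish (q i) \<le> start (q j)"
  shows "feasible_NP m s n p (q ` {1..n})"
proof -
  have pieces: "{a. a \<in> q ` {1..n} \<and> job a = j} = {q j}" if "j \<in> {1..n}" for j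
    using that assms(1) by auto
  have disj: "disjoint_pieces (q i) (q j)"
    if "i \<in> {1..n}" "j \<in> {1..n}" "i \<noteq> j" "machine (q i) = machine (q j)" for i j
    using that assms(2)[of i j] assms(2)[of j i]
    by (cases "i < j") (auto simp: disjoint_pieces_def simp del: Int_greaterThanLessThan)
  have "\<forall>a\<in>q ` {1..n}. \<forall>b\<in>q ` {1..n}. a \<noteq> b \<longrightarrow> machine a = machine b \<longrightarrow> disjoint_pieces a b"
    by (intro ballI impI; elim imageE; metis disj)
  moreover have "\<forall>a\<in>q ` {1..n}. \<forall>b\<in>q ` {1..n}. a \<noteq> b \<longrightarrow> job a = job b \<longrightarrow> disjoint_pieces a b"
    using assms(1) by auto
  moreover have "\<forall>j\<in>{1..n}. (\<Sum>a | a \<in> q ` {1..n} \<and> job a = j. s (machine a) * (finish a - start a)) = p j"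
    using pieces assms(1) by simp
  moreover have "\<forall>j\<in>{1..n}. \<exists>!a. a \<in> q ` {1..n} \<and> job a = j"
  proof
    fix j assume "j \<in> {1..n}"
    with assms(1) show "\<exists>!a. a \<in> q ` {1..n} \<and> job a = j" by (intro ex1I[of _ "q j"]) auto
  qed
  ultimately show ?thesis using assms(1) by (simp add: feasible_NP_def feasible_PP_def)
qed

text \<open>This and the next lemma treat both problems at once: the comparison schedules are
  nonpreemptive, while the schedule to be bounded is only known to be preemptive.\<close>

lemma feasible_NP_schedules: "feasible_NP m s n p S \<Longrightarrow> S \<in> schedules P m s n p"
  by (cases P) (auto simp: feasible_NP_def)

lemma schedules_feasible_PP: "S \<in> schedules P m s n p \<Longrightarrow> feasible_PP m s n p S"
  by (cases P) (auto simp: feasible_NP_def)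

lemma length_loads [simp]: "length (loads m S) = m"
  by (simp add: loads_def)

lemma sum_list_take_loads:
  assumes "k \<le> m"
  shows "sum_list (take k (loads m S)) = (\<Sum>i=1..k. load S i)"
proof -
  have "take k (loads m S) = map (load S) [1..<Suc k]"
    using assms by (simp add: loads_def take_map del: upt_Suc)
  then show ?thesis
    by (simp add: interv_sum_list_conv_sum_set_nat atLeastLessThanSuc_atLeastAtMost del: upt_Suc)
qed

text \<open>The speeds double as processing times, so job \<open>i\<close> takes time 1 on machine
  \<open>i\<close>.\<close>

lemma ex_schedule_unit_loads:
  assumes "\<And>i. i \<in> {1..m} \<Longrightarrow> 0 < s i"
  shows "\<exists>T. feasible_NP m s m s T \<and> loads m T = replicate m 1"
proof -
  define q where "q j = \<lparr>job = j, machine = j, start = 0, finish = 1\<rparr>" for j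
  have "feasible_NP m s m s (q ` {1..m})"
    by (rule feasible_NP_imageI) (auto simp: q_def)
  moreover have "load (q ` {1..m}) i = 1" if "i \<in> {1..m}" for i
  proof -
    have "{a \<in> q ` {1..m}. machine a = i} = {q i}" using that by (auto simp: q_def)
    then show ?thesis by (simp add: load_def q_def)
  qed
  then have "loads m (q ` {1..m}) = replicate m 1"
    by (intro replicate_eqI) (auto simp: loads_def simp del: upt_Suc)
  ultimately show ?thesis by blast
qed

lemma ex_schedule_serial:
  assumes "1 \<le> m" "0 < s 1" "\<And>j. j \<in> {1..n} \<Longrightarrow> 0 < p j"
  shows "\<exists>T. feasible_NP m s n p T \<and> (\<Sum>i=1..m. load T i) \<le> (\<Sum>j=1..n. p j) / s 1"
proof -
  \<comment> \<open>\<open>F j\<close> is the completion time of job \<open>j\<close> when machine 1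
    runs all jobs in order of index, with \<open>F 0 = 0\<close>.\<close>
  define F where "F j = (\<Sum>i=1..j. p i) / s 1" for j :: nat
  define q where "q j = \<lparr>job = j, machine = 1, start = F (j - 1), finish = F j\<rparr>" for j
  have F_step: "F j = F (j - 1) + p j / s 1" if "j \<ge> 1" for j
    using that by (cases j) (auto simp: F_def add_divide_distrib)
  have F_mono: "F i \<le> F j" if "i \<le> j" "j \<le> n" for i j
    unfolding F_def using that assms(2,3)
    by (intro divide_right_mono sum_mono2) (auto intro: less_imp_le)
  have F_nonneg: "0 \<le> F j" if "j \<le> n" for j
    using F_mono[of 0 j] that by (simp add: F_def)
  have "feasible_NP m s n p (q ` {1..n})"
  proof (rule feasible_NP_imageI)
    fix j assume j: "j \<in> {1..n}"
    have "F j = F (j - 1) + p j / s 1" "0 \<le> F (j - 1)" using j F_step[of j] F_nonneg[of "j - 1"] by auto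
    then show "job (q j) = j \<and> machine (q j) \<in> {1..m} \<and> 0 \<le> start (q j)
      \<and> start (q j) < finish (q j) \<and> s (machine (q j)) * (finish (q j) - start (q j)) = p j"
      using assms j by (simp add: q_def)
  next
    fix i j assume "i \<in> {1..n}" "j \<in> {1..n}" "i < j"
    then show "finish (q i) \<le> start (q j)" by (auto simp: q_def intro: F_mono)
  qed
  moreover have "load (q ` {1..n}) i = 0" if "i \<noteq> 1" for i
  proof -
    have "{a \<in> q ` {1..n}. machine a = i} = {}" using that by (auto simp: q_def)
    then show ?thesis unfolding load_def by (simp only: image_empty Max_singleton)
  qed
  then have "(\<Sum>i=1..m. load (q ` {1..n}) i) = load (q ` {1..n}) 1"
    using assms(1) by (subst sum.mono_neutral_right[of _ "{1}"]) auto
  moreover have "load (q ` {1..n}) 1 \<le> F n"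
    unfolding load_def using F_nonneg[of n] F_mono by (auto simp: q_def)
  ultimately show ?thesis unfolding F_def by auto
qed

section \<open>The bound for one instance\<close>

text \<open>Used twice: with constant \<open>f\<close> for the prefix sums of the truncated weights,
  and with \<open>f = s\<close> for the work these weights represent.\<close>

lemma sum_truncated:
  fixes f :: "nat \<Rightarrow> real"
  assumes "t \<le> k"
  shows "(\<Sum>i=1..k. f i * (if i \<le> t then 1 else if i = t + 1 then \<Delta> else 0)) =
    (\<Sum>i=1..t. f i) + (if t < k then \<Delta> * f (t + 1) else 0)"
  using assms by (induction k rule: dec_induct) auto

lemma instance_ratio_ge:
  fixes s :: "nat \<Rightarrow> real"
  assumes "1 \<le> m" and pos: "\<And>i. i \<in> {1..m} \<Longrightarrow> 0 < s i"
    and mono: "\<And>i j. 1 \<le> i \<Longrightarrow> i \<le> j \<Longrightarrow> j \<le> m \<Longrightarrow> s j \<le> s i"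
    and last: "s (m + 1) = 0"
    and t: "1 \<le> t" "t \<le> m" and \<Delta>: "0 \<le> \<Delta>"
    and sum: "(\<Sum>i=1..m. s i) / s 1 = real t + \<Delta>"
  shows "ereal ((\<Sum>i=1..m. s i) / ((\<Sum>i=1..t. s i) + \<Delta> * s (t + 1))) \<le> instance_ratio P m s m s"
  unfolding instance_ratio_def schedule_ratio_def
\<comment> \<open>Both infima are bounded below by bounding every factor \<open>\<alpha>\<close>
  admissible for an arbitrary schedule \<open>S\<close>.\<close>
proof (intro INF_greatest Inf_greatest, clarsimp)
  fix S \<alpha>
  assume S: "S \<in> schedules P m s m s"
    and \<alpha>: "\<forall>T\<in>schedules P m s m s. loads m S \<preceq>\<^sub>s map ((*) \<alpha>) (loads m T)"
  have feas: "feasible_PP m s m s S" using S by (rule schedules_feasible_PP)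
  then have finS: "finite S" by (simp add: feasible_PP_def)
  obtain T where T: "feasible_NP m s m s T" "loads m T = replicate m 1"
    using ex_schedule_unit_loads[of m s] pos by blast
  obtain U where U: "feasible_NP m s m s U" "(\<Sum>i=1..m. load U i) \<le> real t + \<Delta>"
    using ex_schedule_serial[of m s m s] assms by auto
  have le_k: "(\<Sum>i=1..k. load S i) \<le> real k * \<alpha>" if "k \<le> m" for k
  proof -
    have "loads m S \<preceq>\<^sub>s map ((*) \<alpha>) (loads m T)" using \<alpha> feasible_NP_schedules[OF T(1)] by blast
    then show ?thesis
      using submajorized_replicate_le[of "loads m S" m \<alpha> k] that T(2)
      by (simp add: sum_list_take_loads)
  qed
  \<comment> \<open>The sign of \<open>\<alpha>\<close> keeps the scaled loads of \<open>U\<close>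
    nonnegative and lets the bound on their total be multiplied by \<open>\<alpha>\<close>.\<close>
  have "0 \<le> \<alpha>" using le_k[OF \<open>1 \<le> m\<close>] load_nonneg[OF finS, of 1] by simp
  have finU: "finite U" using U by (simp add: feasible_NP_def feasible_PP_def)
  have le_\<tau>: "(\<Sum>i=1..k. load S i) \<le> \<alpha> * (real t + \<Delta>)" if "k \<le> m" for k
  proof -
    have "(\<Sum>i=1..k. load S i) = sum_list (take k (loads m S))"
      using that by (simp add: sum_list_take_loads)
    also have "\<dots> \<le> sum_list (map ((*) \<alpha>) (loads m U))"
    proof (rule submajorized_nonneg_le)
      show "loads m S \<preceq>\<^sub>s map ((*) \<alpha>) (loads m U)" using \<alpha> feasible_NP_schedules[OF U(1)] by blast
      show "0 \<le> y" if "y \<in> set (map ((*) \<alpha>) (loads m U))" for y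
        using that \<open>0 \<le> \<alpha>\<close> finU by (auto simp: loads_def load_nonneg)
    qed (use that in simp)
    also have "\<dots> = \<alpha> * sum_list (loads m U)"
      using sum_list_const_mult[of \<alpha> "\<lambda>x. x" "loads m U"] by simp
    also have "\<dots> = \<alpha> * (\<Sum>i=1..m. load U i)"
      using sum_list_take_loads[of m m U] by simp
    also have "\<dots> \<le> \<alpha> * (real t + \<Delta>)" using U \<open>0 \<le> \<alpha>\<close> by (intro mult_left_mono)
    finally show ?thesis .
  qed
  \<comment> \<open>The extremal load profile: the prefix sums of \<open>\<alpha> * c i\<close>
    attain the cap of \<open>le_k\<close> up to \<open>t\<close> and the cap of
    \<open>le_\<tau>\<close> beyond \<open>t\<close>.\<close>
  define c where "c i = (if i \<le> t then 1 else if i = t + 1 then \<Delta> else 0)" for i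
  have c: "(\<Sum>i=1..k. load S i) \<le> (\<Sum>i=1..k. \<alpha> * c i)" if "k \<in> {1..m}" for k
  proof (cases "k \<le> t")
    case True
    then have "(\<Sum>i=1..k. \<alpha> * c i) = (\<Sum>i=1..k. \<alpha>)" by (intro sum.cong) (auto simp: c_def)
    then show ?thesis using le_k[of k] that by simp
  next
    case False
    then have "(\<Sum>i=1..k. \<alpha> * c i) = \<alpha> * (real t + \<Delta>)"
      using sum_truncated[of t k "\<lambda>_. \<alpha>" \<Delta>] by (simp add: c_def algebra_simps)
    then show ?thesis using le_\<tau>[of k] that by simp
  qed
  have "(\<Sum>i=1..m. s i) \<le> (\<Sum>i=1..m. s i * load S i)"
    using feas pos by (intro total_work_le) (auto intro: less_imp_le)
  also have "\<dots> \<le> (\<Sum>i=1..m. s i * (\<alpha> * c i))"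
    using pos mono c by (intro sum_mult_antimono_le) (auto intro: less_imp_le)
  also have "\<dots> = \<alpha> * (\<Sum>i=1..m. s i * c i)"
    by (simp add: sum_distrib_left mult_ac)
  \<comment> \<open>For \<open>t = m\<close> the sum has no term with index \<open>t + 1\<close>;
    the right-hand side agrees because \<open>s (m + 1) = 0\<close>.\<close>
  also have "(\<Sum>i=1..m. s i * c i) = (\<Sum>i=1..t. s i) + \<Delta> * s (t + 1)"
    using sum_truncated[of t m s \<Delta>] t last by (cases "t = m") (auto simp: c_def)
  finally have "(\<Sum>i=1..m. s i) \<le> \<alpha> * ((\<Sum>i=1..t. s i) + \<Delta> * s (t + 1))" .
  moreover have "0 < (\<Sum>i=1..t. s i)" using t pos by (intro sum_pos) auto
  moreover have "0 \<le> \<Delta> * s (t + 1)"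
    using \<Delta> t last pos[of "t + 1"] by (cases "t = m") auto
  ultimately show "(\<Sum>i=Suc 0..m. s i) / ((\<Sum>i=Suc 0..t. s i) + \<Delta> * s (Suc t)) \<le> \<alpha>"
    by (simp add: divide_le_eq)
qed

section \<open>From one instance to \<open>WAR\<close>\<close>

lemma instance_ratio_le_WAR:
  assumes "s \<in> V" "(n, p) \<in> job_sets"
  shows "instance_ratio P m s n p \<le> WAR P m V"
  unfolding WAR_def using assms by (auto intro!: SUP_upper2[of s] SUP_upper2[of "(n, p)"])

text \<open>The set \<open>V\<close> stays arbitrary so that \<open>{s}\<close> covers fixed speeds
  and \<open>speed_vectors m\<close> covers speeds in the input.\<close>

lemma WAR_ge:
  assumes "1 \<le> m" "s \<in> V" "\<And>i. i \<in> {1..m} \<Longrightarrow> 0 < s i"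
    and "\<And>i j. 1 \<le> i \<Longrightarrow> i \<le> j \<Longrightarrow> j \<le> m \<Longrightarrow> s j \<le> s i"
    and "s (m + 1) = 0" "1 \<le> t" "t \<le> m" "0 \<le> \<Delta>"
    and "(\<Sum>i=1..m. s i) / s 1 = real t + \<Delta>"
  shows "ereal ((\<Sum>i=1..m. s i) / ((\<Sum>i=1..t. s i) + \<Delta> * s (t + 1))) \<le> WAR P m V"
proof -
  have "(m, s) \<in> job_sets" using assms by (auto simp: job_sets_def)
  then have "instance_ratio P m s m s \<le> WAR P m V" using assms(2) by (intro instance_ratio_le_WAR)
  with instance_ratio_ge[OF assms(1,3-9)] show ?thesis by (rule order_trans)
qed

lemma WAR_speed_vectors_ge:
  assumes "1 \<le> m"
  shows "ereal ((sqrt (real m) + 1) / 2) \<le> WAR P m (speed_vectors m)"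
proof -
  define r where "r = sqrt (real m)"
  \<comment> \<open>The total speed is \<open>r + m = r * (1 + r)\<close>, so its quotient by
    \<open>s 1\<close> is exactly \<open>r\<close>, which splits into \<open>t\<close> and
    \<open>\<Delta>\<close>. The first \<open>t\<close> speeds sum up to \<open>r + t\<close>, and
    adding \<open>\<Delta>\<close> makes the denominator \<open>2 * r\<close>.\<close>
  define s where "s i = (if i = 1 then 1 + r else if i \<le> m then 1 else 0)" for i
  define t where "t = nat \<lfloor>r\<rfloor>"
  define \<Delta> where "\<Delta> = r - real t"
  have r: "1 \<le> r" "r * r = real m" using assms by (auto simp: r_def)
  have t: "1 \<le> t" "real t \<le> r" using r by (auto simp: t_def le_nat_floor)
  have "r \<le> r * r" using r(1) by simp
  then have "t \<le> m" using t r by linarith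
  have sum_s: "(\<Sum>i=1..k. s i) = r + real k" if "1 \<le> k" "k \<le> m" for k
    using that by (induction k rule: dec_induct) (auto simp: s_def)
  \<comment> \<open>If \<open>t = m\<close>, then \<open>s (t + 1)\<close> is 0 rather than 1, but
    \<open>t \<le> r \<le> m\<close> forces \<open>r = t\<close> and hence
    \<open>\<Delta> = 0\<close>.\<close>
  have last: "\<Delta> * s (t + 1) = \<Delta>"
  proof (cases "t = m")
    case True
    then have "r = real m" using t r \<open>r \<le> r * r\<close> by simp
    then show ?thesis using True by (simp add: \<Delta>_def)
  qed (use \<open>t \<le> m\<close> \<open>1 \<le> t\<close> in \<open>auto simp: s_def\<close>)
  have "(\<Sum>i=1..m. s i) / ((\<Sum>i=1..t. s i) + \<Delta> * s (t + 1)) = (r + r * r) / (2 * r)"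
    unfolding last using sum_s[of m] sum_s[of t] assms t \<open>t \<le> m\<close> r by (simp add: \<Delta>_def)
  also have "\<dots> = (r + 1) / 2" using r(1) by (simp add: field_simps)
  finally have bound: "(\<Sum>i=1..m. s i) / ((\<Sum>i=1..t. s i) + \<Delta> * s (t + 1)) = (r + 1) / 2" .
  have "ereal ((\<Sum>i=1..m. s i) / ((\<Sum>i=1..t. s i) + \<Delta> * s (t + 1))) \<le> WAR P m (speed_vectors m)"
  proof (rule WAR_ge)
    show "(\<Sum>i=1..m. s i) / s 1 = real t + \<Delta>"
      unfolding sum_s[OF assms order_refl] using r by (simp add: \<Delta>_def s_def divide_eq_eq algebra_simps)
  qed (use assms r t \<open>t \<le> m\<close> in \<open>auto simp: s_def speed_vectors_def \<Delta>_def\<close>)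
  then show ?thesis unfolding bound by (simp add: r_def)
qed

theorem theorem11:
  fixes m :: nat
  assumes "1 \<le> m"
  shows "(\<forall>(s :: nat \<Rightarrow> real) (t :: nat) (\<Delta> :: real).
            (\<forall>i\<in>{1..m}. 0 < s i) \<and>
            (\<forall>i\<in>{1..m}. \<forall>j\<in>{1..m}. i \<le> j \<longrightarrow> s j \<le> s i) \<and>
            s (m + 1) = 0 \<and>
            1 \<le> t \<and> t \<le> m \<and> 0 \<le> \<Delta> \<and> \<Delta> < 1 \<and>
            (\<Sum>i=1..m. s i) / s 1 = real t + \<Delta> \<longrightarrow>
            (\<forall>P\<in>{NP, PP}.
               WAR P m {s} \<ge> ereal ((\<Sum>i=1..m. s i) / ((\<Sum>i=1..t. s i) + \<Delta> * s (t + 1))))) \<and>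
         (\<forall>P\<in>{NP, PP}. WAR P m (speed_vectors m) \<ge> ereal ((sqrt (real m) + 1) / 2))"
proof (intro conjI allI impI ballI)
  fix s :: "nat \<Rightarrow> real" and t :: nat and \<Delta> :: real and P
  assume "(\<forall>i\<in>{1..m}. 0 < s i) \<and>
    (\<forall>i\<in>{1..m}. \<forall>j\<in>{1..m}. i \<le> j \<longrightarrow> s j \<le> s i) \<and>
    s (m + 1) = 0 \<and>
    1 \<le> t \<and> t \<le> m \<and> 0 \<le> \<Delta> \<and> \<Delta> < 1 \<and>
    (\<Sum>i=1..m. s i) / s 1 = real t + \<Delta>"
  then show "WAR P m {s} \<ge> ereal ((\<Sum>i=1..m. s i) / ((\<Sum>i=1..t. s i) + \<Delta> * s (t + 1)))"
    using assms by (intro WAR_ge) auto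
qed (rule WAR_speed_vectors_ge[OF assms])

end
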